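(* Let $k\ge 2$ be an integer and let $\lambda_k$ be the unique positive root of $(k-1)\lambda^k+(2k+2)\lambda-k-1=0$ (it lies in $(0,1/2)$). If $\lambda_k\le\lambda<1/2$, then $$\{x^k y : x,y\in C_\lambda\}=[0,1],$$ where $C_\lambda=\{(1-\lambda)\sum_{i=1}^\infty d_i\lambda^{i-1} : d_i\in\{0,1\}\}$. Moreover, the sequence $(\lambda_k)_{k\ge2}$ is increasing and converges to $1/2$ as $k\to\infty$.
   Context: For $\lambda\in(0,1/2)$, $C_\lambda$ is the middle Cantor set with convex hull $[0,1]$, i.e. the unique nonempty compact set with $C_\lambda=\varphi_0(C_\lambda)\cup\varphi_1(C_\lambda)$, $\varphi_i(x)=\lambda x+i(1-\lambda)$. *)

theory Defs
  imports "HOL-Analysis.Analysis"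
begin

text \<open>Digits are indexed from 0 here, so the series is
  \<open>(1 - lam) * (d 0 + d 1 * lam + d 2 * lam\<^sup>2 + \<dots>)\<close>; it converges for \<open>0 < lam < 1/2\<close>,
  the range in which the definition is used.\<close>

definition cantor_set :: "real \<Rightarrow> real set" where
  "cantor_set lam = {(1 - lam) * (\<Sum>i. d i * lam ^ i) | d :: nat \<Rightarrow> real. \<forall>i. d i \<in> {0, 1}}"

definition is_lambda_root :: "nat \<Rightarrow> real \<Rightarrow> bool" where
  "is_lambda_root k x \<longleftrightarrow>
     x > 0 \<and> (real k - 1) * x ^ k + (2 * real k + 2) * x - real k - 1 = 0"

definition lambda_root :: "nat \<Rightarrow> real" where
  "lambda_root k = (THE x. is_lambda_root k x)"

definition cantor_map :: "real \<Rightarrow> real \<Rightarrow> real \<Rightarrow> real" where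
  "cantor_map lam i x = lam * x + i * (1 - lam)"

lemma summable_digits:
  fixes lam :: real and d :: "nat \<Rightarrow> real"
  assumes "0 < lam" "lam < 1/2" "\<forall>i. d i \<in> {0, 1}"
  shows "summable (\<lambda>i. d i * lam ^ i)"
proof (rule summable_comparison_test')
  show "summable (\<lambda>i. lam ^ i)" using assms by (intro summable_geometric) auto
  show "norm (d n * lam ^ n) \<le> lam ^ n" for n
    using assms(1) assms(3)[rule_format, of n] by auto
qed

lemma cantor_set_self_similar:
  assumes "0 < lam" "lam < 1/2"
  shows "cantor_set lam = cantor_map lam 0 ` cantor_set lam \<union> cantor_map lam 1 ` cantor_set lam"
    (is "?C = ?R")
proof
  show "?C \<subseteq> ?R"
  proof
    fix x assume "x \<in> ?C"
    then obtain d where d: "\<forall>i. d i \<in> {0, 1::real}" and x: "x = (1 - lam) * (\<Sum>i. d i * lam ^ i)"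
      unfolding cantor_set_def by blast
    define y where "y = (1 - lam) * (\<Sum>i. d (Suc i) * lam ^ i)"
    have y: "y \<in> ?C" unfolding y_def cantor_set_def
      using d by (intro CollectI exI[of _ "\<lambda>i. d (Suc i)"]) auto
    have s: "summable (\<lambda>i. d (Suc i) * lam ^ i)"
      using d by (intro summable_digits assms) auto
    have "(\<Sum>i. d i * lam ^ i) = d 0 + (\<Sum>i. lam * (d (Suc i) * lam ^ i))"
      using suminf_split_head[OF summable_digits[OF assms d]] by (simp add: mult_ac)
    also have "\<dots> = d 0 + lam * (\<Sum>i. d (Suc i) * lam ^ i)"
      using suminf_mult[OF s] by simp
    finally have "x = cantor_map lam (d 0) y"
      unfolding x y_def cantor_map_def by (simp add: algebra_simps)
    moreover have "d 0 \<in> {0, 1}" using d by simp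
    ultimately show "x \<in> ?R" using y by auto
  qed
  have "cantor_map lam c y \<in> ?C" if "y \<in> ?C" and c: "c \<in> {0, 1}" for c y
  proof -
    obtain d where d: "\<forall>i. d i \<in> {0, 1::real}" and y: "y = (1 - lam) * (\<Sum>i. d i * lam ^ i)"
      using \<open>y \<in> ?C\<close> unfolding cantor_set_def by blast
    define e where "e = case_nat c d"
    have e: "\<forall>i. e i \<in> {0, 1}" using d c unfolding e_def by (auto split: nat.split)
    have "(\<Sum>i. e i * lam ^ i) = c + (\<Sum>i. lam * (d i * lam ^ i))"
      using suminf_split_head[OF summable_digits[OF assms e]] by (simp add: e_def mult_ac)
    also have "\<dots> = c + lam * (\<Sum>i. d i * lam ^ i)"
      using suminf_mult[OF summable_digits[OF assms d]] by simp
    finally have "cantor_map lam c y = (1 - lam) * (\<Sum>i. e i * lam ^ i)"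
      unfolding y cantor_map_def by (simp add: algebra_simps)
    then show ?thesis unfolding cantor_set_def using e by blast
  qed
  then show "?R \<subseteq> ?C" by auto
qed

lemma compact_cantor_set:
  assumes "0 < lam" "lam < 1/2"
  shows "compact (cantor_set lam)"
proof -
  define D :: "(nat \<Rightarrow> real) set" where "D = (\<Pi>\<^sub>E i\<in>UNIV. {0, 1})"
  have "compactin (product_topology (\<lambda>i::nat. euclideanreal) UNIV) D"
    unfolding D_def by (subst compactin_PiE) (auto simp: finite_imp_compact)
  then have D: "compact D" by (simp add: euclidean_product_topology)
  have M: "norm (d n * lam ^ n) \<le> lam ^ n" if "d \<in> D" for n d
  proof -
    have "d n \<in> {0, 1}" using that unfolding D_def by (auto simp: PiE_iff)
    then show ?thesis using assms by auto
  qed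
  have "uniform_limit D (\<lambda>n d. \<Sum>i<n. d i * lam ^ i) (\<lambda>d. \<Sum>i. d i * lam ^ i) sequentially"
    using assms by (intro Weierstrass_m_test[OF M] summable_geometric) auto
  moreover have "continuous_on D (\<lambda>d. \<Sum>i<n. d i * lam ^ i)" for n
    by (intro continuous_intros continuous_on_subset[OF continuous_on_product_coordinates]) auto
  ultimately have "continuous_on D (\<lambda>d. \<Sum>i. d i * lam ^ i)"
    by (intro uniform_limit_theorem[where F = sequentially]) auto
  then have "continuous_on D (\<lambda>d. (1 - lam) * (\<Sum>i. d i * lam ^ i))"
    by (intro continuous_intros)
  moreover have "cantor_set lam = (\<lambda>d. (1 - lam) * (\<Sum>i. d i * lam ^ i)) ` D"
    unfolding cantor_set_def D_def by (auto simp: PiE_iff image_iff)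
  ultimately show ?thesis using compact_continuous_image[OF _ D] by metis
qed

text \<open>The digit description is the attractor of the two similarities.\<close>

lemma cantor_set_unique_attractor:
  assumes "0 < lam" "lam < 1/2"
  shows "K = cantor_set lam \<longleftrightarrow>
    compact K \<and> K \<noteq> {} \<and> K = cantor_map lam 0 ` K \<union> cantor_map lam 1 ` K"
proof
  assume "K = cantor_set lam"
  moreover have "cantor_set lam \<noteq> {}" unfolding cantor_set_def by (auto intro!: exI[of _ "\<lambda>_. 0"])
  ultimately show "compact K \<and> K \<noteq> {} \<and> K = cantor_map lam 0 ` K \<union> cantor_map lam 1 ` K"
    using compact_cantor_set[OF assms] cantor_set_self_similar[OF assms] by simp
next
  assume "compact K \<and> K \<noteq> {} \<and> K = cantor_map lam 0 ` K \<union> cantor_map lam 1 ` K"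
  then have K: "compact K" "K \<noteq> {}" and eq: "K = cantor_map lam 0 ` K \<union> cantor_map lam 1 ` K"
    by blast+
  have mapK: "cantor_map lam c u \<in> K" if "c \<in> {0, 1}" "u \<in> K" for c u
    by (subst eq) (use that in auto)
  obtain B where B: "\<And>x. x \<in> K \<Longrightarrow> norm x \<le> B"
    using compact_imp_bounded[OF K(1)] unfolding bounded_iff by blast
  have pow0: "(\<lambda>n. lam ^ n * z n) \<longlonglongrightarrow> 0" if "\<And>n. z n \<in> K" for z :: "nat \<Rightarrow> real"
  proof (rule Lim_null_comparison)
    show "\<forall>\<^sub>F n in sequentially. norm (lam ^ n * z n) \<le> lam ^ n * B"
      using B[OF that] assms by (auto simp: abs_mult intro!: always_eventually mult_left_mono)
    show "(\<lambda>n. lam ^ n * B) \<longlonglongrightarrow> 0"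
      using assms by (intro tendsto_mult_left_zero LIMSEQ_power_zero) auto
  qed
  have lim: "(\<lambda>n. (1 - lam) * (\<Sum>i<n. d i * lam ^ i) + lam ^ n * z n)
      \<longlonglongrightarrow> (1 - lam) * (\<Sum>i. d i * lam ^ i)"
    if "\<forall>i. d i \<in> {0, 1}" "\<And>n. z n \<in> K" for d z :: "nat \<Rightarrow> real"
  proof -
    have "(\<lambda>n. (1 - lam) * (\<Sum>i<n. d i * lam ^ i) + lam ^ n * z n)
      \<longlonglongrightarrow> (1 - lam) * (\<Sum>i. d i * lam ^ i) + 0"
      by (intro tendsto_add tendsto_mult_left pow0 that summable_LIMSEQ summable_digits assms)
    then show ?thesis by simp
  qed
  show "K = cantor_set lam"
  proof
    show "K \<subseteq> cantor_set lam"
    proof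
      fix x assume x: "x \<in> K"
      have "\<forall>y\<in>K. \<exists>c y'. c \<in> {0, 1} \<and> y' \<in> K \<and> y = cantor_map lam c y'" using eq by blast
      then obtain c g where cg: "\<And>y. y \<in> K \<Longrightarrow> c y \<in> {0, 1} \<and> g y \<in> K \<and> y = cantor_map lam (c y) (g y)"
        by metis
      define z where "z n = (g ^^ n) x" for n
      define d where "d n = c (z n)" for n
      have z: "z n \<in> K" for n unfolding z_def by (induction n) (use x cg in auto)
      have d: "\<forall>i. d i \<in> {0, 1}" using cg z unfolding d_def by blast
      have step: "z n = lam * z (Suc n) + d n * (1 - lam)" for n
        using cg[OF z[of n]] unfolding cantor_map_def d_def z_def by simp
      have part: "x = (1 - lam) * (\<Sum>i<n. d i * lam ^ i) + lam ^ n * z n" for n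
      proof (induction n)
        case 0 then show ?case by (simp add: z_def)
      next
        case (Suc n)
        have "lam ^ n * z n = lam ^ n * (lam * z (Suc n) + d n * (1 - lam))"
          using step[of n] by simp
        with Suc show ?case by (simp add: algebra_simps)
      qed
      have "(\<lambda>n. x) \<longlonglongrightarrow> (1 - lam) * (\<Sum>i. d i * lam ^ i)"
        using lim[OF d z, of "\<lambda>n. n"] by (simp only: part[symmetric])
      then have "x = (1 - lam) * (\<Sum>i. d i * lam ^ i)" by (simp add: LIMSEQ_const_iff)
      then show "x \<in> cantor_set lam" using d unfolding cantor_set_def by blast
    qed
    show "cantor_set lam \<subseteq> K"
    proof
      fix x assume "x \<in> cantor_set lam"
      then obtain d where d: "\<forall>i. d i \<in> {0, 1::real}" and x: "x = (1 - lam) * (\<Sum>i. d i * lam ^ i)"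
        unfolding cantor_set_def by blast
      obtain w where w: "w \<in> K" using K(2) by blast
      have inK: "(1 - lam) * (\<Sum>i<n. e i * lam ^ i) + lam ^ n * u \<in> K"
        if "\<forall>i. e i \<in> {0, 1}" "u \<in> K" for e :: "nat \<Rightarrow> real" and u n
        using that(2)
      proof (induction n arbitrary: u)
        case 0 then show ?case by simp
      next
        case (Suc n)
        have "e n \<in> {0, 1}" using that(1) by blast
        then have "cantor_map lam (e n) u \<in> K" using mapK Suc.prems by blast
        from Suc.IH[OF this] show ?case
          by (simp add: cantor_map_def algebra_simps)
      qed
      show "x \<in> K" unfolding x
        by (rule closed_sequentially[OF compact_imp_closed[OF K(1)] _ lim[OF d, of "\<lambda>_. w"]])
          (use inK[OF d w] w in auto)
    qed
  qed
qed

end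

theory Submission
  imports Defs
begin

text \<open>
  A square \<open>[a, a + s] \<times> [b, b + s]\<close> of the construction has four children of side \<open>lam * s\<close>. If,
  for a function \<open>f\<close> increasing in both variables, the images of the four children are intervals of
  which consecutive ones meet, then they cover the image of the square; following a value down through
  the levels and passing to the limit, \<open>f\<close> maps the product of two Cantor sets onto the image of the
  whole square. For \<open>f x y = x ^ k * y\<close> on \<open>[1 - lam, 1]\<^sup>2\<close>, Bernoulli's inequality shows that
  consecutive images meet as soon as \<open>k * (1 - 2 * lam) \<le> 1 - lam\<close>, which covers \<open>[lam, 1]\<close>;
  multiplying \<open>y\<close> by powers of \<open>lam\<close> extends this to \<open>(0, 1]\<close>. At \<open>lam \<ge> lambda_root k\<close> the defining
  equation gives \<open>1 - 2 * lam \<le> lam ^ k\<close>, which is more than enough.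
\<close>

subsection \<open>Cantor sets\<close>

lemma zero_in_cantor_set: "0 \<in> cantor_set lam"
  unfolding cantor_set_def by (auto intro!: exI[of _ "\<lambda>_. 0"])

lemma one_in_cantor_set:
  assumes "0 < lam" "lam < 1/2"
  shows "1 \<in> cantor_set lam"
proof -
  have "1 = (1 - lam) * (\<Sum>i. 1 * lam ^ i)"
    using assms by (simp add: suminf_geometric)
  then show ?thesis unfolding cantor_set_def by (intro CollectI exI[of _ "\<lambda>_. 1"]) simp
qed

lemma cantor_set_subset_unit_interval:
  assumes "0 < lam" "lam < 1/2"
  shows "cantor_set lam \<subseteq> {0..1}"
proof
  fix x assume "x \<in> cantor_set lam"
  then obtain d where d: "\<forall>i. d i \<in> {0, 1::real}" and x: "x = (1 - lam) * (\<Sum>i. d i * lam ^ i)"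
    unfolding cantor_set_def by blast
  have d01: "0 \<le> d i \<and> d i \<le> 1" for i using d[rule_format, of i] by auto
  note summable = summable_digits[OF assms d]
  have "0 \<le> (\<Sum>i. d i * lam ^ i)"
    using d01 assms by (intro suminf_nonneg summable) auto
  moreover have "(\<Sum>i. d i * lam ^ i) \<le> (\<Sum>i. lam ^ i)"
    using d01 assms by (intro suminf_le summable summable_geometric)
      (auto intro: mult_left_le_one_le)
  moreover have "(\<Sum>i. lam ^ i) = 1 / (1 - lam)" using assms by (intro suminf_geometric) auto
  ultimately have "0 \<le> (\<Sum>i. d i * lam ^ i)" "(\<Sum>i. d i * lam ^ i) \<le> 1 / (1 - lam)"
    by linarith+
  then show "x \<in> {0..1}" using assms unfolding x by (simp add: le_divide_eq mult.commute)
qed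

lemma cantor_map_in_cantor_set:
  assumes "0 < lam" "lam < 1/2" "i \<in> {0, 1}" "x \<in> cantor_set lam"
  shows "cantor_map lam i x \<in> cantor_set lam"
  using cantor_set_self_similar[OF assms(1,2)] assms(3,4) by blast

text \<open>The condition \<open>a \<in> cantor_corner lam s\<close> stands in for \<open>[a, a + s]\<close> being a construction
  interval of the Cantor set, so that no addressing of intervals by digit strings is needed.\<close>

definition cantor_corner :: "real \<Rightarrow> real \<Rightarrow> real set" where
  "cantor_corner lam s = {a. \<forall>x\<in>cantor_set lam. a + s * x \<in> cantor_set lam}"

lemma cantor_corner_in_cantor_set:
  assumes "0 < lam" "lam < 1/2" "a \<in> cantor_corner lam s"
  shows "a \<in> cantor_set lam" "a + s \<in> cantor_set lam"
  using assms zero_in_cantor_set[of lam] one_in_cantor_set[of lam]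
  unfolding cantor_corner_def by force+

lemma cantor_corner_child:
  assumes "0 < lam" "lam < 1/2" "a \<in> cantor_corner lam s"
    and "a' \<in> {a, a + (1 - lam) * s}"
  shows "a' \<in> cantor_corner lam (lam * s)"
proof -
  obtain i where i: "i \<in> {0, 1}" and a': "a' = a + s * (i * (1 - lam))"
    using assms(4) by (force simp: mult.commute)
  have "a' + lam * s * x \<in> cantor_set lam" if "x \<in> cantor_set lam" for x
  proof -
    have "a + s * cantor_map lam i x \<in> cantor_set lam"
      using assms(3) cantor_map_in_cantor_set[OF assms(1,2) i that]
      unfolding cantor_corner_def by blast
    then show ?thesis unfolding a' cantor_map_def by (simp add: algebra_simps)
  qed
  then show ?thesis unfolding cantor_corner_def by blast
qed

subsection \<open>Images of products of Cantor sets\<close>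

text \<open>In the order left-left, left-right, right-left, right-right, the image of each child square
  starts before that of its predecessor ends.\<close>

definition child_images_overlap ::
    "real \<Rightarrow> (real \<Rightarrow> real \<Rightarrow> real) \<Rightarrow> real \<Rightarrow> real \<Rightarrow> real \<Rightarrow> bool" where
  "child_images_overlap lam f s a b \<longleftrightarrow>
     f a (b + (1 - lam) * s) \<le> f (a + lam * s) (b + lam * s) \<and>
     f (a + (1 - lam) * s) b \<le> f (a + lam * s) (b + s) \<and>
     f (a + (1 - lam) * s) (b + (1 - lam) * s) \<le> f (a + s) (b + lam * s)"

lemma child_images_overlap_affine:
  "child_images_overlap lam (\<lambda>x y. f (c * x + u) (c * y + v)) s a b \<longleftrightarrow>
   child_images_overlap lam f (c * s) (c * a + u) (c * b + v)"
  unfolding child_images_overlap_def by (simp add: algebra_simps)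

lemma ex_child_square_between:
  assumes "child_images_overlap lam f s a b" and "t \<in> {f a b..f (a + s) (b + s)}"
  shows "\<exists>a'\<in>{a, a + (1 - lam) * s}. \<exists>b'\<in>{b, b + (1 - lam) * s}.
           t \<in> {f a' b'..f (a' + lam * s) (b' + lam * s)}"
proof -
  let ?a = "a + (1 - lam) * s" and ?b = "b + (1 - lam) * s"
  have right_end: "c + (1 - lam) * s + lam * s = c + s" for c by (simp add: algebra_simps)
  consider "t \<in> {f a b..f (a + lam * s) (b + lam * s)}"
    | "t \<in> {f a ?b..f (a + lam * s) (?b + lam * s)}"
    | "t \<in> {f ?a b..f (?a + lam * s) (b + lam * s)}"
    | "t \<in> {f ?a ?b..f (?a + lam * s) (?b + lam * s)}"
    using assms unfolding right_end child_images_overlap_def atLeastAtMost_iff by linarith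
  then show ?thesis by cases blast+
qed

lemma ex_cantor_corners_between:
  fixes f :: "real \<Rightarrow> real \<Rightarrow> real"
  assumes lam: "0 < lam" "lam < 1/2"
    and overlap: "\<And>s a b. 0 \<le> s \<Longrightarrow> a \<in> {0..1 - s} \<Longrightarrow> b \<in> {0..1 - s} \<Longrightarrow>
      child_images_overlap lam f s a b"
    and t: "t \<in> {f 0 0..f 1 1}"
  shows "\<exists>a\<in>cantor_corner lam (lam ^ n). \<exists>b\<in>cantor_corner lam (lam ^ n).
           t \<in> {f a b..f (a + lam ^ n) (b + lam ^ n)}"
proof (induction n)
  case 0
  have "0 \<in> cantor_corner lam (lam ^ 0)" unfolding cantor_corner_def by simp
  then show ?case using t by force
next
  case (Suc n)
  then obtain a b where a: "a \<in> cantor_corner lam (lam ^ n)" and b: "b \<in> cantor_corner lam (lam ^ n)"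
    and between: "t \<in> {f a b..f (a + lam ^ n) (b + lam ^ n)}"
    by blast
  have "c \<in> {0..1 - lam ^ n}" if "c \<in> cantor_corner lam (lam ^ n)" for c
    using cantor_corner_in_cantor_set[OF lam that] cantor_set_subset_unit_interval[OF lam] by force
  then have "child_images_overlap lam f (lam ^ n) a b"
    using a b lam by (intro overlap) auto
  from ex_child_square_between[OF this between] show ?case
    using cantor_corner_child[OF lam a] cantor_corner_child[OF lam b] unfolding power_Suc by blast
qed

lemma compact_image_mem_between:
  fixes f :: "'a::metric_space \<Rightarrow> real"
  assumes S: "compact S" "continuous_on S f" and K: "compact K" "K \<subseteq> S"
    and pq: "\<And>n::nat. p n \<in> K" "\<And>n. q n \<in> S" "(\<lambda>n. dist (p n) (q n)) \<longlonglongrightarrow> 0"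
    and t: "\<And>n. t \<in> {f (p n)..f (q n)}"
  shows "t \<in> f ` K"
proof -
  have dist_images: "(\<lambda>n. dist (f (p n)) (f (q n))) \<longlonglongrightarrow> 0"
    using compact_uniformly_continuous[OF S(2,1)] pq K(2)
    unfolding uniformly_continuous_on_sequentially by blast
  have "norm (f (p n) - t) \<le> dist (f (p n)) (f (q n))" for n
    using t[of n] by (simp add: dist_real_def)
  then have "(\<lambda>n. f (p n) - t) \<longlonglongrightarrow> 0"
    by (intro Lim_null_comparison[OF _ dist_images] always_eventually) blast
  then have "(\<lambda>n. f (p n)) \<longlonglongrightarrow> t" by (rule LIM_zero_cancel)
  moreover have "closed (f ` K)"
    using compact_continuous_image[OF continuous_on_subset[OF S(2) K(2)] K(1)]
    by (rule compact_imp_closed)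
  moreover have "f (p n) \<in> f ` K" for n using pq(1) by blast
  ultimately show ?thesis using closed_sequentially[of "f ` K" "\<lambda>n. f (p n)" t] by blast
qed

theorem interval_subset_image_cantor_set_Times:
  fixes f :: "real \<Rightarrow> real \<Rightarrow> real"
  assumes lam: "0 < lam" "lam < 1/2"
    and cont: "continuous_on ({0..1} \<times> {0..1}) (\<lambda>(x, y). f x y)"
    and overlap: "\<And>s a b. 0 \<le> s \<Longrightarrow> a \<in> {0..1 - s} \<Longrightarrow> b \<in> {0..1 - s} \<Longrightarrow>
      child_images_overlap lam f s a b"
  shows "{f 0 0..f 1 1} \<subseteq> (\<lambda>(x, y). f x y) ` (cantor_set lam \<times> cantor_set lam)"
proof
  fix t assume "t \<in> {f 0 0..f 1 1}"
  then have "\<forall>n. \<exists>a\<in>cantor_corner lam (lam ^ n). \<exists>b\<in>cantor_corner lam (lam ^ n).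
      t \<in> {f a b..f (a + lam ^ n) (b + lam ^ n)}"
    using ex_cantor_corners_between[OF lam overlap] by blast
  then obtain a b where a: "\<And>n. a n \<in> cantor_corner lam (lam ^ n)"
    and b: "\<And>n. b n \<in> cantor_corner lam (lam ^ n)"
    and between: "\<And>n. t \<in> {f (a n) (b n)..f (a n + lam ^ n) (b n + lam ^ n)}"
    by metis
  note corner = cantor_corner_in_cantor_set[OF lam]
  show "t \<in> (\<lambda>(x, y). f x y) ` (cantor_set lam \<times> cantor_set lam)"
  proof (rule compact_image_mem_between[OF _ cont,
        where p = "\<lambda>n. (a n, b n)" and q = "\<lambda>n. (a n + lam ^ n, b n + lam ^ n)"])
    show "compact ({0..1::real} \<times> {0..1::real})" by (intro compact_Times compact_Icc)
    show "compact (cantor_set lam \<times> cantor_set lam)"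
      by (intro compact_Times compact_cantor_set lam)
    show "cantor_set lam \<times> cantor_set lam \<subseteq> {0..1} \<times> {0..1}"
      using cantor_set_subset_unit_interval[OF lam] by (intro Sigma_mono)
    show "(a n, b n) \<in> cantor_set lam \<times> cantor_set lam" for n
      using corner(1)[OF a] corner(1)[OF b] by blast
    show "(a n + lam ^ n, b n + lam ^ n) \<in> {0..1} \<times> {0..1}" for n
      using corner(2)[OF a] corner(2)[OF b] cantor_set_subset_unit_interval[OF lam] by blast
    have "(\<lambda>n. sqrt ((lam ^ n)\<^sup>2 + (lam ^ n)\<^sup>2)) \<longlonglongrightarrow> sqrt (0\<^sup>2 + 0\<^sup>2)"
      using lam by (intro tendsto_intros LIMSEQ_power_zero) auto
    then show "(\<lambda>n. dist (a n, b n) (a n + lam ^ n, b n + lam ^ n)) \<longlonglongrightarrow> 0"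
      by (simp add: dist_Pair_Pair dist_real_def)
  qed (use between in auto)
qed

subsection \<open>The function \<open>x ^ k * y\<close>\<close>

lemma Bernoulli_power_mult_le:
  fixes x y h e :: real
  assumes "0 < x" "- x \<le> h" "0 \<le> y" and gain: "x * e \<le> real k * h * y"
  shows "x ^ k * (y + e) \<le> (x + h) ^ k * y"
proof -
  have "y + e \<le> (1 + real k * (h / x)) * y"
    using gain \<open>0 < x\<close> by (simp add: field_simps)
  also have "\<dots> \<le> (1 + h / x) ^ k * y"
    using assms by (intro mult_right_mono Bernoulli_inequality) (auto simp: field_simps)
  finally have "x ^ k * (y + e) \<le> x ^ k * ((1 + h / x) ^ k * y)"
    using \<open>0 < x\<close> by (intro mult_left_mono) auto
  also have "\<dots> = (x * (1 + h / x)) ^ k * y" by (simp add: power_mult_distrib)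
  also have "x * (1 + h / x) = x + h" using \<open>0 < x\<close> by (simp add: field_simps)
  finally show ?thesis .
qed

lemma third_le_of_gap_le:
  fixes lam :: real
  assumes "2 \<le> k" "lam < 1/2" "real k * (1 - 2 * lam) \<le> 1 - lam"
  shows "1/3 \<le> lam"
proof -
  have "2 * (1 - 2 * lam) \<le> real k * (1 - 2 * lam)"
    using assms by (intro mult_right_mono) auto
  also note assms(3)
  finally show ?thesis by simp
qed

lemma child_images_overlap_power_mult:
  assumes k: "2 \<le> k" and lam: "lam < 1/2" and gap: "real k * (1 - 2 * lam) \<le> 1 - lam"
    and s: "0 \<le> s" and a: "a \<in> {1 - lam..1 - s}" and b: "b \<in> {1 - lam..1 - s}"
  shows "child_images_overlap lam (\<lambda>x y. x ^ k * y) s a b"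
proof -
  define g where "g = (1 - 2 * lam) * s"
  have third: "1/3 \<le> lam" using third_le_of_gap_le[OF k lam gap] .
  have "0 \<le> lam * s" "0 \<le> g" using third lam s unfolding g_def by auto
  then have pos: "0 < a" "0 < a + lam * s" "0 < a + lam * s + g" "0 \<le> b + lam * s" "0 \<le> b + s"
    using a b lam s unfolding atLeastAtMost_iff by linarith+
  have right_start: "c + (1 - lam) * s = c + lam * s + g" for c
    unfolding g_def by (simp add: algebra_simps)
  have right_end: "c + lam * s + g + lam * s = c + s" for c
    unfolding g_def by (simp add: algebra_simps)
  have gap_y: "x ^ k * (b + lam * s + g) \<le> (x + lam * s) ^ k * (b + lam * s)"
    if x: "0 < x" "x \<le> 1" for x
  proof (rule Bernoulli_power_mult_le)
    have "1 - 2 * lam \<le> (2 * (1/3)) * (1/2)" using third by simp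
    also have "\<dots> \<le> (real k * lam) * (b + lam * s)"
      using third lam k b \<open>0 \<le> lam * s\<close> by (intro mult_mono) auto
    finally have "g \<le> (real k * lam) * (b + lam * s) * s"
      unfolding g_def using s by (intro mult_right_mono)
    moreover have "x * g \<le> g" using x \<open>0 \<le> g\<close> by (intro mult_left_le_one_le) auto
    ultimately show "x * g \<le> real k * (lam * s) * (b + lam * s)" by (simp add: mult_ac)
  qed (use x pos \<open>0 \<le> lam * s\<close> in auto)
  have gap_x: "(a + lam * s + g) ^ k * (b + s + - s) \<le> (a + lam * s + g + - g) ^ k * (b + s)"
  proof (rule Bernoulli_power_mult_le)
    have "real k * (1 - 2 * lam) \<le> a + lam * s + g"
      using gap a \<open>0 \<le> lam * s\<close> \<open>0 \<le> g\<close> unfolding atLeastAtMost_iff by linarith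
    then have "(real k * (1 - 2 * lam)) * (b + s) * s \<le> (a + lam * s + g) * 1 * s"
      using b s pos by (intro mult_right_mono mult_mono) auto
    then show "(a + lam * s + g) * - s \<le> real k * - g * (b + s)"
      unfolding g_def by (simp add: mult_ac)
  qed (use pos in auto)
  show ?thesis
    using gap_y[of a] gap_x gap_y[of "a + lam * s + g"] right_end[of a]
      pos a s lam \<open>0 \<le> lam * s\<close> \<open>0 \<le> g\<close>
    unfolding child_images_overlap_def right_start by auto
qed

lemma unit_interval_subset_of_scaling:
  fixes c :: real
  assumes c: "0 < c" "c < 1" and "0 \<in> P" and top: "{c..1} \<subseteq> P"
    and scale: "\<And>t. t \<in> P \<Longrightarrow> c * t \<in> P"
  shows "{0..1} \<subseteq> P"
proof
  have levels: "{c ^ Suc n..1} \<subseteq> P" for n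
  proof (induction n)
    case 0
    then show ?case using top by simp
  next
    case (Suc n)
    have "t \<in> P" if "t \<in> {c ^ Suc (Suc n)..1}" "t < c" for t
    proof -
      have "t / c \<in> {c ^ Suc n..1}" using that c by (simp add: field_simps)
      then have "c * (t / c) \<in> P" using Suc.IH by (intro scale) blast
      then show ?thesis using c by simp
    qed
    then show ?case using top by force
  qed
  fix t :: real assume t: "t \<in> {0..1}"
  show "t \<in> P"
  proof (cases "t = 0")
    case False
    then obtain n where "c ^ n < t" using t c real_arch_pow_inv[of t c] by auto
    moreover have "c ^ Suc n \<le> c ^ n" using c by (intro power_decreasing) auto
    ultimately show ?thesis using levels[of n] t by auto
  qed (use \<open>0 \<in> P\<close> in simp)
qed

lemma atLeastAtMost_subset_power_mult_cantor_set:
  assumes k: "2 \<le> k" and lam: "lam < 1/2" and gap: "real k * (1 - 2 * lam) \<le> 1 - lam"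
  shows "{(1 - lam) ^ Suc k..1} \<subseteq> {x ^ k * y | x y. x \<in> cantor_set lam \<and> y \<in> cantor_set lam}"
    (is "_ \<subseteq> ?P")
proof -
  have pos: "0 < lam" using third_le_of_gap_le[OF assms] by simp
  let ?f = "\<lambda>x y. cantor_map lam 1 x ^ k * cantor_map lam 1 y"
  have overlap: "child_images_overlap lam ?f s a b"
    if "0 \<le> s" "a \<in> {0..1 - s}" "b \<in> {0..1 - s}" for s a b
  proof -
    have "lam * c + 1 * (1 - lam) \<in> {1 - lam..1 - lam * s}" if "c \<in> {0..1 - s}" for c
      using that pos mult_left_mono[of c "1 - s" lam] by (simp add: algebra_simps)
    then show ?thesis
      unfolding cantor_map_def child_images_overlap_affine[where f = "\<lambda>x y. x ^ k * y"]
      using that pos by (intro child_images_overlap_power_mult k lam gap) auto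
  qed
  have "continuous_on ({0..1} \<times> {0..1}) (\<lambda>(x, y). ?f x y)"
    unfolding cantor_map_def split_def by (intro continuous_intros)
  then have "{?f 0 0..?f 1 1} \<subseteq> (\<lambda>(x, y). ?f x y) ` (cantor_set lam \<times> cantor_set lam)"
    using overlap by (rule interval_subset_image_cantor_set_Times[OF pos lam])
  also have "\<dots> \<subseteq> ?P"
    using cantor_map_in_cantor_set[OF pos lam, of 1] by auto
  finally show ?thesis by (simp add: cantor_map_def mult.commute)
qed

theorem power_mult_cantor_set_eq_unit_interval:
  assumes k: "2 \<le> k" and lam: "lam < 1/2" and gap: "real k * (1 - 2 * lam) \<le> 1 - lam"
  shows "{x ^ k * y | x y. x \<in> cantor_set lam \<and> y \<in> cantor_set lam} = {0..1}" (is "?P = _")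
proof
  have third: "1/3 \<le> lam" using third_le_of_gap_le[OF assms] .
  then have pos: "0 < lam" by simp
  have "0 \<le> x \<and> x \<le> 1" if "x \<in> cantor_set lam" for x
    using cantor_set_subset_unit_interval[OF pos lam] that by auto
  then show "?P \<subseteq> {0..1}"
    by (auto intro!: mult_le_one power_le_one mult_nonneg_nonneg)
  show "{0..1} \<subseteq> ?P"
  proof (rule unit_interval_subset_of_scaling)
    show "0 < lam" "lam < 1" using pos lam by auto
    show "0 \<in> ?P" using zero_in_cantor_set[of lam] by force
    show "lam * t \<in> ?P" if t: "t \<in> ?P" for t
    proof -
      obtain x y where "x \<in> cantor_set lam" "y \<in> cantor_set lam" "t = x ^ k * y"
        using t by blast
      then show ?thesis
        using cantor_map_in_cantor_set[OF pos lam, of 0 y]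
        by (intro CollectI exI[of _ x] exI[of _ "lam * y"]) (auto simp: cantor_map_def)
    qed
    have "(1 - lam) ^ Suc k \<le> (1 - lam) ^ 3"
      using k lam third by (intro power_decreasing) auto
    also have "\<dots> \<le> (2/3) ^ 3" using lam third by (intro power_mono) auto
    also have "\<dots> \<le> lam" using third by (simp add: power3_eq_cube)
    finally have "{lam..1} \<subseteq> {(1 - lam) ^ Suc k..1}" by simp
    then show "{lam..1} \<subseteq> ?P"
      using atLeastAtMost_subset_power_mult_cantor_set[OF assms] by (rule subset_trans)
  qed
qed

subsection \<open>The roots \<open>lambda_root k\<close>\<close>

definition lambda_poly :: "nat \<Rightarrow> real \<Rightarrow> real" where
  "lambda_poly k x = (real k - 1) * x ^ k - (real k + 1) * (1 - 2 * x)"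

lemma is_lambda_root_iff: "is_lambda_root k x \<longleftrightarrow> 0 < x \<and> lambda_poly k x = 0"
  unfolding is_lambda_root_def lambda_poly_def by (auto simp: algebra_simps)

lemma strict_mono_on_lambda_poly:
  assumes "1 \<le> k"
  shows "strict_mono_on {0..} (lambda_poly k)"
proof (rule strict_mono_onI)
  fix x y :: real assume "x \<in> {0..}" "y \<in> {0..}" "x < y"
  then have "(real k - 1) * x ^ k \<le> (real k - 1) * y ^ k"
    using assms by (intro mult_left_mono power_mono) auto
  moreover have "(real k + 1) * (1 - 2 * y) < (real k + 1) * (1 - 2 * x)"
    using \<open>x < y\<close> by (intro mult_strict_left_mono) auto
  ultimately show "lambda_poly k x < lambda_poly k y" unfolding lambda_poly_def by linarith
qed

lemma ex1_is_lambda_root: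
  assumes "1 \<le> k"
  shows "\<exists>!x. is_lambda_root k x"
proof -
  have at_0: "lambda_poly k 0 < 0"
    using assms unfolding lambda_poly_def by (simp add: power_0_left)
  moreover have "0 \<le> lambda_poly k (1/2)" using assms unfolding lambda_poly_def by simp
  moreover have "continuous_on {0..1/2} (lambda_poly k)"
    unfolding lambda_poly_def by (intro continuous_intros)
  ultimately obtain x where "0 \<le> x" "lambda_poly k x = 0"
    using IVT'[of "lambda_poly k" 0 0 "1/2"] by auto
  with at_0 have "is_lambda_root k x" unfolding is_lambda_root_iff by (cases "x = 0") auto
  moreover have "z = y" if "is_lambda_root k y" "is_lambda_root k z" for y z
    using that strict_mono_on_imp_inj_on[OF strict_mono_on_lambda_poly[OF assms]]
    unfolding is_lambda_root_iff inj_on_def by auto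
  ultimately show ?thesis by blast
qed

lemma
  assumes "1 \<le> k"
  shows lambda_root_pos: "0 < lambda_root k"
    and lambda_poly_lambda_root: "lambda_poly k (lambda_root k) = 0"
proof -
  have "is_lambda_root k (lambda_root k)"
    unfolding lambda_root_def by (rule theI'[OF ex1_is_lambda_root[OF assms]])
  then show "0 < lambda_root k" "lambda_poly k (lambda_root k) = 0"
    unfolding is_lambda_root_iff by blast+
qed

lemma lambda_root_le_iff:
  assumes "1 \<le> k" "0 \<le> x"
  shows "lambda_root k \<le> x \<longleftrightarrow> 0 \<le> lambda_poly k x"
  using strict_mono_on_less_eq[OF strict_mono_on_lambda_poly[OF assms(1)], of "lambda_root k" x]
    lambda_root_pos[OF assms(1)] lambda_poly_lambda_root[OF assms(1)] assms(2) by simp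

lemma less_lambda_root_iff:
  assumes "1 \<le> k" "0 \<le> x"
  shows "x < lambda_root k \<longleftrightarrow> lambda_poly k x < 0"
  using lambda_root_le_iff[OF assms] by linarith

lemma lambda_root_less_half:
  assumes "2 \<le> k"
  shows "lambda_root k < 1/2"
proof -
  have half: "0 < lambda_poly k (1/2)" using assms unfolding lambda_poly_def by simp
  then have "lambda_root k \<le> 1/2" using lambda_root_le_iff[of k "1/2"] assms by simp
  moreover have "lambda_root k \<noteq> 1/2" using half lambda_poly_lambda_root[of k] assms by force
  ultimately show ?thesis by simp
qed

lemma one_minus_twice_le_power_if_lambda_root_le:
  assumes k: "1 \<le> k" and x: "lambda_root k \<le> x"
  shows "1 - 2 * x \<le> x ^ k"
proof -
  have "0 \<le> x" using lambda_root_pos[OF k] x by simp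
  then have "(real k + 1) * (1 - 2 * x) \<le> (real k - 1) * x ^ k"
    using x lambda_root_le_iff[OF k] unfolding lambda_poly_def by simp
  also have "\<dots> \<le> (real k + 1) * x ^ k" using \<open>0 \<le> x\<close> by (intro mult_right_mono) auto
  finally show ?thesis by (rule mult_left_le_imp_le) simp
qed

lemma mult_one_minus_twice_le_half:
  assumes k: "1 \<le> k" and lam: "lambda_root k \<le> lam" "lam < 1/2"
  shows "real k * (1 - 2 * lam) \<le> 1/2"
proof -
  have "1 - 2 * lam \<le> lam ^ k" using one_minus_twice_le_power_if_lambda_root_le[OF k lam(1)] .
  also have "\<dots> \<le> (1/2) ^ k" using lambda_root_pos[OF k] lam by (intro power_mono) auto
  finally have "real k * (1 - 2 * lam) \<le> real k * (1/2) ^ k" by (intro mult_left_mono) auto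
  also have "\<dots> \<le> 1/2"
  proof -
    obtain n where n: "k = Suc n" using k by (cases k) auto
    have "2 * real k \<le> 2 ^ k" using Bernoulli_inequality[of "1::real" n] unfolding n by simp
    then show ?thesis by (simp add: power_one_over field_simps)
  qed
  finally show ?thesis .
qed

lemma lambda_root_less_Suc:
  assumes k: "2 \<le> k"
  shows "lambda_root k < lambda_root (Suc k)"
proof -
  define x where "x = lambda_root k"
  have x: "0 < x" "x < 1/2" "lambda_poly k x = 0"
    using lambda_root_pos lambda_root_less_half lambda_poly_lambda_root k unfolding x_def by auto
  have "(real k + 1) * lambda_poly (Suc k) x
      = (real k + 1) * lambda_poly (Suc k) x - (real k + 2) * lambda_poly k x"
    using x(3) by simp
  also have "\<dots> = ((real k * (real k + 1)) * x - (real k + 2) * (real k - 1)) * x ^ k"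
    unfolding lambda_poly_def by (simp add: algebra_simps)
  also have "\<dots> < 0"
  proof (intro mult_neg_pos)
    have "2 * 2 \<le> real k * real k" using k by (intro mult_mono) auto
    have "(real k * (real k + 1)) * x < (real k * (real k + 1)) * (1/2)"
      using x k by (intro mult_strict_left_mono) auto
    also have "\<dots> \<le> (real k + 2) * (real k - 1)"
      using \<open>2 * 2 \<le> real k * real k\<close> k by (simp add: algebra_simps)
    finally show "(real k * (real k + 1)) * x - (real k + 2) * (real k - 1) < 0" by simp
  qed (use x in simp)
  finally have "lambda_poly (Suc k) x < 0" by (simp add: mult_less_0_iff)
  then show ?thesis using less_lambda_root_iff[of "Suc k" x] x unfolding x_def by simp
qed

lemma strict_mono_on_lambda_root: "strict_mono_on {2..} lambda_root"
proof (rule strict_mono_onI)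
  fix m n :: nat assume "m \<in> {2..}" "m < n"
  from \<open>m < n\<close> have "2 \<le> m \<longrightarrow> lambda_root m < lambda_root n"
    by (induction rule: less_Suc_induct) (auto intro: lambda_root_less_Suc)
  then show "lambda_root m < lambda_root n" using \<open>m \<in> {2..}\<close> by simp
qed

lemma lambda_root_tendsto_half: "lambda_root \<longlonglongrightarrow> 1/2"
proof (rule real_tendsto_sandwich)
  have "1/2 - (1/2) ^ k \<le> lambda_root k" if "2 \<le> k" for k
  proof -
    have "1 - 2 * lambda_root k \<le> lambda_root k ^ k"
      using that by (intro one_minus_twice_le_power_if_lambda_root_le) auto
    also have "\<dots> \<le> (1/2) ^ k"
      using that lambda_root_pos[of k] lambda_root_less_half[of k] by (intro power_mono) auto
    also have "\<dots> \<le> 2 * (1/2) ^ k" by simp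
    finally show ?thesis by simp
  qed
  then show "\<forall>\<^sub>F k in sequentially. 1/2 - (1/2) ^ k \<le> lambda_root k"
    unfolding eventually_sequentially by blast
  show "\<forall>\<^sub>F k in sequentially. lambda_root k \<le> 1/2"
    unfolding eventually_sequentially using lambda_root_less_half by (meson less_imp_le)
  have "(\<lambda>k. 1/2 - (1/2) ^ k) \<longlonglongrightarrow> 1/2 - (0::real)"
    by (intro tendsto_diff tendsto_const LIMSEQ_power_zero) auto
  then show "(\<lambda>k. 1/2 - (1/2) ^ k) \<longlonglongrightarrow> (1/2::real)" by simp
qed (rule tendsto_const)

theorem theorem1p2:
  shows "(\<forall>k::nat. k \<ge> 2 \<longrightarrow>
            (\<exists>!x. is_lambda_root k x) \<and>
            0 < lambda_root k \<and> lambda_root k < 1/2 \<and>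
            (\<forall>lam::real. lambda_root k \<le> lam \<and> lam < 1/2 \<longrightarrow>
               {x ^ k * y | x y. x \<in> cantor_set lam \<and> y \<in> cantor_set lam} = {0..1}))
         \<and> strict_mono_on {2..} lambda_root
         \<and> lambda_root \<longlonglongrightarrow> 1/2"
proof (intro conjI allI impI strict_mono_on_lambda_root lambda_root_tendsto_half)
  fix k :: nat assume k: "k \<ge> 2"
  then have "1 \<le> k" by simp
  then show "\<exists>!x. is_lambda_root k x" "0 < lambda_root k"
    by (rule ex1_is_lambda_root, rule lambda_root_pos)
  show "lambda_root k < 1/2" using k by (rule lambda_root_less_half)
  fix lam :: real assume lam: "lambda_root k \<le> lam \<and> lam < 1/2"
  then have "real k * (1 - 2 * lam) \<le> 1/2" using \<open>1 \<le> k\<close> by (intro mult_one_minus_twice_le_half) auto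
  also have "\<dots> \<le> 1 - lam" using lam by simp
  finally show "{x ^ k * y | x y. x \<in> cantor_set lam \<and> y \<in> cantor_set lam} = {0..1}"
    using k lam by (intro power_mult_cantor_set_eq_unit_interval) auto
qed

end
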